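(* The integral $Q_{0}(a)$, depending on the parameter $a$, is given by $$Q_{0}(a) = \int_{0}^{1} e^{-ax} \ln x \, dx = -\frac{1}{a} \left( \gamma + \ln a + \Gamma(0,a) \right).$$
   Context: $Q_{0}(a)$ is the case $n=0$ (the initial condition) of the family $Q_{n}(a) = \int_{0}^{1} x^{n} e^{-ax} \ln x \, dx$. Here $\gamma = \lim_{n\to\infty}\left(\sum_{k=1}^{n} \frac{1}{k} - \ln n\right)$ is Euler's constant, and $\Gamma(0,a)$ is the value at $s=0$, $x=a$ of the incomplete gamma function $\Gamma(s,x) = \int_{x}^{\infty} t^{s-1} e^{-t}\, dt$. *)

theory Defs
  imports "HOL-Analysis.Analysis"
begin

text \<open>Henstock--Kurzweil integrals agree with the (convergent) improper Riemann integrals.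
  At the endpoint \<open>0\<close> the integrand of \<open>Q\<close> takes the conventional value given by \<open>ln 0 = 0\<close>,
  which does not affect the integral.\<close>

definition Q :: "nat \<Rightarrow> real \<Rightarrow> real" where
  "Q n a = integral {0..1} (\<lambda>x. x ^ n * exp (- a * x) * ln x)"

definition upper_incomplete_Gamma :: "real \<Rightarrow> real \<Rightarrow> real" where
  "upper_incomplete_Gamma s x = integral {x..} (\<lambda>t. t powr (s - 1) * exp (- t))"

end

theory Submission
  imports Defs "HOL-Real_Asymp.Real_Asymp"
begin

text \<open>Integration by parts against \<open>(1 - exp (- a x)) / a\<close>, the antiderivative of \<open>exp (- a x)\<close>
  that vanishes at \<open>0\<close>, turns the integral into \<open>- 1 / a\<close> times the integral of
  \<open>(1 - exp (- t)) / t\<close> over \<open>[0, a]\<close>. To evaluate the latter, write the harmonic number \<open>H\<^sub>n\<close> as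
  the integral of \<open>(1 - (1 - t / n) ^ n) / t\<close> over \<open>[0, n]\<close> and split it at \<open>a\<close>. On \<open>[a, n]\<close> the
  term \<open>1 / t\<close> contributes \<open>ln n - ln a\<close>; the two remaining integrals converge by dominated
  convergence, and \<open>H\<^sub>n - ln n\<close> tends to Euler's constant.\<close>

text \<open>With \<open>u = 1 - t / n\<close> one has \<open>t = n * (1 - u)\<close>, so the
  integrand is the geometric sum of the \<open>u ^ k\<close>, \<open>k < n\<close>, divided by
  \<open>n\<close>; its terms integrate to \<open>1 / Suc k\<close>.\<close>

lemma has_integral_harm:
  fixes n :: nat
  assumes "n > 0"
  shows "((\<lambda>t. (1 - (1 - t / n) ^ n) / t) has_integral harm n) {0..real n}"
proof -
  define F where "F = (\<lambda>t::real. - (\<Sum>k<n. (1 - t / n) ^ Suc k / Suc k))"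
  have "((\<lambda>t. (\<Sum>k<n. (1 - t / n) ^ k) / n) has_integral F n - F 0) {0..real n}"
  proof (rule fundamental_theorem_of_calculus)
    fix t :: real
    have "((\<lambda>t. (1 - t / n) ^ Suc k / Suc k) has_real_derivative - ((1 - t / n) ^ k / n))
            (at t within {0..real n})" for k
    proof -
      have "((\<lambda>t. (1 - t / n) ^ Suc k / Suc k) has_real_derivative
              real (Suc k) * (1 - t / n) ^ k * - (1 / n) / Suc k) (at t within {0..real n})"
        using assms by (intro DERIV_cdivide) (auto intro!: derivative_eq_intros simp del: power_Suc)
      then show ?thesis by simp
    qed
    then have "(F has_real_derivative - (\<Sum>k<n. - ((1 - t / n) ^ k / n))) (at t within {0..real n})"
      unfolding F_def by (intro DERIV_minus DERIV_sum)
    thus "(F has_vector_derivative (\<Sum>k<n. (1 - t / n) ^ k) / n) (at t within {0..real n})"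
      by (simp add: has_real_derivative_iff_has_vector_derivative sum_negf sum_divide_distrib)
  qed auto
  also have "F n - F 0 = harm n"
    using assms by (simp add: F_def harm_altdef inverse_eq_divide)
  finally show ?thesis
  \<comment> \<open>The two integrands differ at \<open>t = 0\<close>: the quotient is 0 there by
    the convention for division by zero, the sum gives 1.\<close>
  proof (rule has_integral_spike_finite[of "{0}", rotated 2])
    fix t assume "t \<in> {0..real n} - {0}"
    then show "(1 - (1 - t / n) ^ n) / t = (\<Sum>k<n. (1 - t / n) ^ k) / n"
      using assms one_diff_power_eq[of "1 - t / n" n] by simp
  qed auto
qed

lemma LIMSEQ_one_minus_power_exp: "(\<lambda>n. (1 - t / real n) ^ n) \<longlonglongrightarrow> exp (- t)"
  using tendsto_exp_limit_sequentially[of "- t"] by simp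

text \<open>The constant 1 dominates: for \<open>0 < t \<le> a \<le> n\<close>, Bernoulli's
  inequality gives \<open>1 - t \<le> (1 - t / n) ^ n \<le> 1\<close>, so the quotient by
  \<open>t\<close> lies between 0 and 1.\<close>

lemma
  fixes a :: real
  assumes "a > 0"
  shows integrable_one_minus_exp_over: "(\<lambda>t. (1 - exp (- t)) / t) integrable_on {0..a}"
    and tendsto_integral_one_minus_exp_over:
      "(\<lambda>n. integral {0..a} (\<lambda>t. (1 - (1 - t / real n) ^ n) / t))
         \<longlonglongrightarrow> integral {0..a} (\<lambda>t. (1 - exp (- t)) / t)"
proof -
  \<comment> \<open>For \<open>n < a\<close> the base \<open>1 - t / n\<close> can be negative and
    the bound may fail. Shifting the index by \<open>N\<close> ensures \<open>a \<le> n + N\<close>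
    throughout; \<open>LIMSEQ_offset\<close> removes the shift at the end.\<close>
  define N where "N = nat \<lceil>a\<rceil>"
  define f where "f = (\<lambda>n t::real. (1 - (1 - t / real (n + N)) ^ (n + N)) / t)"
  have N: "a \<le> real (n + N)" "n + N > 0" for n
    using assms unfolding N_def by linarith+
  have int: "f n integrable_on {0..a}" for n
    unfolding f_def
    by (rule integrable_on_subinterval[OF has_integral_integrable[OF has_integral_harm[OF N(2)]]])
       (use N(1)[of n] in auto)
  have bound: "norm (f n t) \<le> 1" if "t \<in> {0..a}" for n t
  proof (cases "t = 0")
    case False
    have u: "0 \<le> 1 - t / real (n + N)" "1 - t / real (n + N) \<le> 1"
      using that N[of n] by (auto simp: field_simps)
    have "1 - t \<le> (1 - t / real (n + N)) ^ (n + N)"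
      using Bernoulli_inequality[of "- t / real (n + N)" "n + N"] u(1) N(2)[of n] by auto
    moreover have "(1 - t / real (n + N)) ^ (n + N) \<le> 1"
      using u by (rule power_le_one)
    ultimately show ?thesis
      using that False by (auto simp: f_def field_simps)
  qed (auto simp: f_def)
  have lim: "(\<lambda>n. f n t) \<longlonglongrightarrow> (1 - exp (- t)) / t" for t
    unfolding f_def divide_inverse[of _ t]
    by (intro tendsto_intros LIMSEQ_ignore_initial_segment[OF LIMSEQ_one_minus_power_exp])
  note dom = dominated_convergence[of f "{0..a}" "\<lambda>_. 1", OF int integrable_const_ivl bound lim]
  show "(\<lambda>t. (1 - exp (- t)) / t) integrable_on {0..a}"
    by (rule dom)
  show "(\<lambda>n. integral {0..a} (\<lambda>t. (1 - (1 - t / real n) ^ n) / t))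
         \<longlonglongrightarrow> integral {0..a} (\<lambda>t. (1 - exp (- t)) / t)"
    by (rule LIMSEQ_offset[of _ N]) (use dom(2) in \<open>simp add: f_def\<close>)
qed

lemma tendsto_integral_power_over:
  fixes a :: real
  assumes "a > 0"
  shows "(\<lambda>n. integral {a..real n} (\<lambda>t. (1 - t / real n) ^ n / t))
           \<longlonglongrightarrow> integral {a..} (\<lambda>t. exp (- t) / t)"
proof -
  \<comment> \<open>Extension by zero puts all the integrals on the fixed domain
    \<open>{a..}\<close>, as dominated convergence requires. For fixed \<open>t\<close> the cutoff
    has no effect once \<open>n \<ge> t\<close>. The majorant \<open>exp (- t) / a\<close> combines
    \<open>(1 - t / n) ^ n \<le> exp (- t)\<close> with \<open>1 / t \<le> 1 / a\<close>.\<close>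
  define f where "f = (\<lambda>n t. if t \<in> {a..real n} then (1 - t / real n) ^ n / t else 0)"
  have int: "f n integrable_on {a..}" for n
  proof -
    have "(\<lambda>t. (1 - t / real n) ^ n / t) integrable_on {a..real n}"
      using assms by (intro integrable_continuous_real continuous_intros) (auto simp: divide_inverse)
    moreover have "{a..real n} \<subseteq> {a..}" by auto
    ultimately show ?thesis
      unfolding f_def by (subst integrable_restrict_Int) (simp add: Int_absorb2)
  qed
  have dom: "(\<lambda>t. exp (- t) / a) integrable_on {a..}"
    using integrable_on_exp_minus_to_infinity[of 1 a] by (intro integrable_on_divide) simp
  have bound: "norm (f n t) \<le> exp (- t) / a" if "t \<in> {a..}" for n t
  proof (cases "t \<le> real n")
    case True
    have "n > 0" using True that assms by (cases n) auto
    have "0 \<le> 1 - t / real n"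
      using True that assms \<open>n > 0\<close> by (auto simp: field_simps)
    moreover have "(1 - t / real n) ^ n \<le> exp (- t)"
      using exp_ge_one_minus_x_over_n_power_n[OF True \<open>n > 0\<close>] .
    ultimately show ?thesis
      using that assms True by (auto simp: f_def intro!: frac_le)
  qed (use assms in \<open>auto simp: f_def\<close>)
  have lim: "(\<lambda>n. f n t) \<longlonglongrightarrow> exp (- t) / t" if "t \<in> {a..}" for t
  proof (rule Lim_transform_eventually)
    show "(\<lambda>n. (1 - t / real n) ^ n / t) \<longlonglongrightarrow> exp (- t) / t"
      unfolding divide_inverse[of _ t] by (intro tendsto_intros LIMSEQ_one_minus_power_exp)
    show "eventually (\<lambda>n. (1 - t / real n) ^ n / t = f n t) sequentially"
      using eventually_ge_at_top[of "nat \<lceil>t\<rceil>"]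
      by eventually_elim (use that in \<open>auto simp: f_def\<close>)
  qed
  have "(\<lambda>n. integral {a..} (f n)) \<longlonglongrightarrow> integral {a..} (\<lambda>t. exp (- t) / t)"
    by (rule dominated_convergence(2)[OF int dom bound lim])
  also have "(\<lambda>n. integral {a..} (f n)) = (\<lambda>n. integral {a..real n} (\<lambda>t. (1 - t / real n) ^ n / t))"
  proof
    fix n
    have "{a..} \<inter> {a..real n} = {a..real n}" by auto
    then show "integral {a..} (f n) = integral {a..real n} (\<lambda>t. (1 - t / real n) ^ n / t)"
      unfolding f_def by (subst integral_restrict_Int) (simp add: Int_commute)
  qed
  finally show ?thesis .
qed

lemma integral_one_minus_exp_over:
  fixes a :: real
  assumes "a > 0"
  shows "integral {0..a} (\<lambda>t. (1 - exp (- t)) / t)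
           = euler_mascheroni + ln a + integral {a..} (\<lambda>t. exp (- t) / t)"
proof -
  \<comment> \<open>The identity is exact as soon as \<open>n \<ge> a\<close>, when
    \<open>{0..n}\<close> can be split at \<open>a\<close>. Both sides converge, and comparing their
    limits gives the claim.\<close>
  have "eventually (\<lambda>n. integral {0..a} (\<lambda>t. (1 - (1 - t / real n) ^ n) / t)
          - integral {a..real n} (\<lambda>t. (1 - t / real n) ^ n / t)
        = (harm n - ln (real n)) + ln a) sequentially"
    using eventually_ge_at_top[of "nat \<lceil>a\<rceil>"]
  proof eventually_elim
    case (elim n)
    let ?g = "\<lambda>t. (1 - (1 - t / real n) ^ n) / t"
    have n: "a \<le> real n" "n > 0" using elim assms by linarith+
    have "((\<lambda>t. 1 / t) has_integral ln (real n) - ln a) {a..real n}"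
    proof (rule fundamental_theorem_of_calculus[OF n(1)])
      fix t assume "t \<in> {a..real n}"
      then have "(ln has_real_derivative 1 / t) (at t within {a..real n})"
        using assms by (auto intro!: derivative_eq_intros)
      then show "(ln has_vector_derivative 1 / t) (at t within {a..real n})"
        by (simp add: has_real_derivative_iff_has_vector_derivative)
    qed
    moreover have "(\<lambda>t. (1 - t / real n) ^ n / t) integrable_on {a..real n}"
      using assms by (intro integrable_continuous_real continuous_intros) (auto simp: divide_inverse)
    ultimately have "integral {a..real n} ?g = (ln (real n) - ln a)
        - integral {a..real n} (\<lambda>t. (1 - t / real n) ^ n / t)"
      unfolding diff_divide_distrib
      by (intro integral_unique has_integral_diff integrable_integral)
    moreover have "integral {0..a} ?g + integral {a..real n} ?g = harm n"
      using Henstock_Kurzweil_Integration.integral_combine[of 0 a "real n" ?g] has_integral_harm[OF n(2)] n(1) assms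
      by (auto simp: has_integral_iff)
    ultimately show ?case by simp
  qed
  then have "(\<lambda>n. (harm n - ln (real n)) + ln a) \<longlonglongrightarrow>
      integral {0..a} (\<lambda>t. (1 - exp (- t)) / t) - integral {a..} (\<lambda>t. exp (- t) / t)"
    by (rule Lim_transform_eventually[rotated])
       (intro tendsto_diff tendsto_integral_one_minus_exp_over tendsto_integral_power_over assms)
  moreover have "(\<lambda>n. (harm n - ln (real n)) + ln a) \<longlonglongrightarrow> euler_mascheroni + ln a"
    by (intro tendsto_intros euler_mascheroni_LIMSEQ)
  ultimately show ?thesis
    using LIMSEQ_unique by fastforce
qed

lemma has_integral_exp_times_ln:
  fixes a :: real
  assumes "a > 0"
  shows "((\<lambda>x. exp (- a * x) * ln x) has_integral
            - (1 / a) * integral {0..a} (\<lambda>t. (1 - exp (- t)) / t)) {0..1}"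
proof -
  let ?I = "integral {0..a} (\<lambda>t. (1 - exp (- t)) / t)"
  \<comment> \<open>Since \<open>(1 - exp (- a * x)) / a\<close> behaves like \<open>x\<close> near
    0, it cancels the singularity of \<open>ln\<close>: \<open>G\<close> tends to 0, which is also
    the value \<open>G 0\<close>. As \<open>ln 1 = 0\<close>, both boundary terms vanish.\<close>
  define G where "G = (\<lambda>x. (1 - exp (- a * x)) / a * ln x)"
  have "((\<lambda>t. (1 - exp (- t)) / t) has_integral ?I) {0..a}"
    using integrable_one_minus_exp_over[OF assms] by (rule integrable_integral)
  then have "((\<lambda>x. (1 - exp (- (a * x))) / (a * x)) has_integral ?I / a) ((\<lambda>x. x / a) ` {0..a})"
    using has_integral_stretch_real[of "\<lambda>t. (1 - exp (- t)) / t" ?I 0 a a] assms by simp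
  also have "(\<lambda>x. x / a) ` {0..a} = {0..1}"
    using assms by simp
  finally have quot: "((\<lambda>x. (1 - exp (- (a * x))) / (a * x)) has_integral ?I / a) {0..1}" .
  have "((\<lambda>x. exp (- a * x) * ln x + (1 - exp (- (a * x))) / (a * x)) has_integral G 1 - G 0) {0..1}"
  \<comment> \<open>This version asks only for continuity at the endpoints, where \<open>ln\<close>
    is not differentiable at 0.\<close>
  proof (rule fundamental_theorem_of_calculus_interior)
    have "(G \<longlongrightarrow> G 0) (at_right 0)"
      unfolding G_def using assms by simp real_asymp
    then have "(G \<longlongrightarrow> G x) (at x within {0..1})" if "x \<in> {0..1}" for x
    proof (cases "x = 0")
      case False
      then have "isCont G x"
        using that assms unfolding G_def by (auto intro!: continuous_intros)
      then show ?thesis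
        unfolding isCont_def by (rule tendsto_within_subset) simp
    qed (simp add: at_within_Icc_at_right)
    then show "continuous_on {0..1} G"
      by (simp add: continuous_on_def)
  next
    fix x :: real assume "x \<in> {0<..<1}"
    then have "(G has_real_derivative exp (- a * x) * ln x + (1 - exp (- (a * x))) / (a * x)) (at x)"
      unfolding G_def using assms by (auto intro!: derivative_eq_intros simp: field_simps)
    then show "(G has_vector_derivative exp (- a * x) * ln x + (1 - exp (- (a * x))) / (a * x)) (at x)"
      by (simp add: has_real_derivative_iff_has_vector_derivative)
  qed auto
  from has_integral_diff[OF this quot] show ?thesis
    by (simp add: G_def)
qed

theorem lemma4p2:
  fixes a :: real
  assumes "a > 0"
  shows "Q 0 a = integral {0..1} (\<lambda>x. exp (- a * x) * ln x) \<and>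
         integral {0..1} (\<lambda>x. exp (- a * x) * ln x)
           = - (1 / a) * (euler_mascheroni + ln a + upper_incomplete_Gamma 0 a)"
proof
  show "Q 0 a = integral {0..1} (\<lambda>x. exp (- a * x) * ln x)"
    by (simp add: Q_def)
  have "upper_incomplete_Gamma 0 a = integral {a..} (\<lambda>t. exp (- t) / t)"
    unfolding upper_incomplete_Gamma_def
    by (rule integral_cong) (use assms in \<open>simp add: powr_minus divide_inverse mult.commute\<close>)
  then show "integral {0..1} (\<lambda>x. exp (- a * x) * ln x)
      = - (1 / a) * (euler_mascheroni + ln a + upper_incomplete_Gamma 0 a)"
    using integral_unique[OF has_integral_exp_times_ln[OF assms]]
      integral_one_minus_exp_over[OF assms] by simp
qed

end
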